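(* Let $(C,\Delta_0,\alpha,R)$ be a Hom-coassociative Rota-Baxter coalgebra of weight $0$. Then $(C,\Delta,\alpha)$ is a Hom-preLie coalgebra, where $$\Delta=(R\otimes I)\circ\Delta_0-\tau\circ(I\otimes R)\circ\Delta_0 .$$
   Context: All vector spaces are over a field $\mathbb{F}$ of characteristic $0$; $I$ is the identity map and $\tau(x\otimes y)=y\otimes x$. A Hom-coassociative coalgebra $(C,\Delta,\alpha)$ is a vector space $C$ with linear maps $\Delta:C\to C\otimes C$ and $\alpha:C\to C$ such that $(\alpha\otimes\Delta)\circ\Delta=(\Delta\otimes\alpha)\circ\Delta$. A Hom-coassociative Rota-Baxter coalgebra $(C,\Delta,\alpha,R)$ of weight $\lambda\in\mathbb{F}$ is a Hom-coassociative coalgebra $(C,\Delta,\alpha)$ with a linear map $R:C\to C$ such that $R\circ\alpha=\alpha\circ R$ and $(R\otimes R)\circ\Delta=\big((R\otimes I)\circ\Delta+(I\otimes R)\circ\Delta+\lambda\Delta\big)\circ R$. A Hom-preLie coalgebra $(C,\Delta,\alpha)$ is a vector space $C$ with linear maps $\Delta:C\to C\otimes C$ and $\alpha:C\to C$ such that $(\Delta\otimes\alpha)\circ\Delta-(\alpha\otimes\Delta)\circ\Delta=(\tau\otimes I)\circ\big((\Delta\otimes\alpha)\circ\Delta-(\alpha\otimes\Delta)\circ\Delta\big)$. *)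

theory Defs
  imports "HOL-Algebra.AbelCoset" "Jordan_Normal_Form.Missing_VectorSpace"
begin

section \<open>Tensor products of vector spaces\<close>

text \<open>
  The tensor product of \<open>V\<close> and \<open>W\<close> is the free vector space on \<open>V \<times> W\<close> modulo the
  bilinearity relations. Free vector spaces are spaces of finitely supported functions, and
  quotients consist of cosets. As in \<open>direct_sum\<close>, the fields \<open>mult\<close> and \<open>one\<close> of the module
  record are irrelevant dummies.
\<close>

definition free_space :: "('k, 'm) ring_scheme \<Rightarrow> 's set \<Rightarrow> ('k, 's \<Rightarrow> 'k) module"
  where "free_space K S =
    (ring.func_space K S)\<lparr>carrier := {f \<in> S \<rightarrow>\<^sub>E carrier K. finite {s \<in> S. f s \<noteq> \<zero>\<^bsub>K\<^esub>}}\<rparr>"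

definition free_gen :: "('k, 'm) ring_scheme \<Rightarrow> 's set \<Rightarrow> 's \<Rightarrow> ('s \<Rightarrow> 'k)"
  where "free_gen K S s = (\<lambda>t\<in>S. if t = s then \<one>\<^bsub>K\<^esub> else \<zero>\<^bsub>K\<^esub>)"

definition quotient_module :: "('k, 'v, 'm) module_scheme \<Rightarrow> 'v set \<Rightarrow> ('k, 'v set) module"
  where "quotient_module M N = \<lparr>carrier = a_rcosets\<^bsub>M\<^esub> N,
     mult = (\<lambda>X Y. N),
     one = N,
     zero = N,
     add = (\<lambda>X Y. X <+>\<^bsub>M\<^esub> Y),
     smult = (\<lambda>a X. \<Union>x\<in>X. N +>\<^bsub>M\<^esub> (a \<odot>\<^bsub>M\<^esub> x))\<rparr>"

definition bilinear_relators ::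
    "('k, 'm) ring_scheme \<Rightarrow> ('k, 'v, 'n) module_scheme \<Rightarrow> ('k, 'w, 'p) module_scheme
      \<Rightarrow> ('v \<times> 'w \<Rightarrow> 'k) set"
  where "bilinear_relators K V W =
    (let S = carrier V \<times> carrier W; F = free_space K S; e = free_gen K S in
      {e (v \<oplus>\<^bsub>V\<^esub> v', w) \<ominus>\<^bsub>F\<^esub> (e (v, w) \<oplus>\<^bsub>F\<^esub> e (v', w)) |v v' w.
         v \<in> carrier V \<and> v' \<in> carrier V \<and> w \<in> carrier W} \<union>
      {e (v, w \<oplus>\<^bsub>W\<^esub> w') \<ominus>\<^bsub>F\<^esub> (e (v, w) \<oplus>\<^bsub>F\<^esub> e (v, w')) |v w w'.
         v \<in> carrier V \<and> w \<in> carrier W \<and> w' \<in> carrier W} \<union>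
      {e (a \<odot>\<^bsub>V\<^esub> v, w) \<ominus>\<^bsub>F\<^esub> a \<odot>\<^bsub>F\<^esub> e (v, w) |a v w.
         a \<in> carrier K \<and> v \<in> carrier V \<and> w \<in> carrier W} \<union>
      {e (v, a \<odot>\<^bsub>W\<^esub> w) \<ominus>\<^bsub>F\<^esub> a \<odot>\<^bsub>F\<^esub> e (v, w) |a v w.
         a \<in> carrier K \<and> v \<in> carrier V \<and> w \<in> carrier W})"

definition bilinear_submodule ::
    "('k, 'm) ring_scheme \<Rightarrow> ('k, 'v, 'n) module_scheme \<Rightarrow> ('k, 'w, 'p) module_scheme
      \<Rightarrow> ('v \<times> 'w \<Rightarrow> 'k) set"
  where "bilinear_submodule K V W =
    module.span K (free_space K (carrier V \<times> carrier W)) (bilinear_relators K V W)"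

definition tensor ::
    "('k, 'm) ring_scheme \<Rightarrow> ('k, 'v, 'n) module_scheme \<Rightarrow> ('k, 'w, 'p) module_scheme
      \<Rightarrow> ('k, ('v \<times> 'w \<Rightarrow> 'k) set) module"
  where "tensor K V W =
    quotient_module (free_space K (carrier V \<times> carrier W)) (bilinear_submodule K V W)"

definition pure_tensor ::
    "('k, 'm) ring_scheme \<Rightarrow> ('k, 'v, 'n) module_scheme \<Rightarrow> ('k, 'w, 'p) module_scheme
      \<Rightarrow> 'v \<Rightarrow> 'w \<Rightarrow> ('v \<times> 'w \<Rightarrow> 'k) set"
  where "pure_tensor K V W v w =
    bilinear_submodule K V W +>\<^bsub>free_space K (carrier V \<times> carrier W)\<^esub>
      free_gen K (carrier V \<times> carrier W) (v, w)"

definition bilinear_map ::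
    "('k, 'm) ring_scheme \<Rightarrow> ('k, 'v, 'n) module_scheme \<Rightarrow> ('k, 'w, 'p) module_scheme
      \<Rightarrow> ('k, 'x, 'q) module_scheme \<Rightarrow> ('v \<Rightarrow> 'w \<Rightarrow> 'x) \<Rightarrow> bool"
  where "bilinear_map K V W X B \<longleftrightarrow>
    (\<forall>v\<in>carrier V. linear_map K W X (B v)) \<and> (\<forall>w\<in>carrier W. linear_map K V X (\<lambda>v. B v w))"

text \<open>
  The linear map on the tensor product induced by a bilinear map \<open>B\<close>; existence and uniqueness
  are shown in \<open>tensor_universal\<close> below.
\<close>

definition tensor_lift ::
    "('k, 'm) ring_scheme \<Rightarrow> ('k, 'v, 'n) module_scheme \<Rightarrow> ('k, 'w, 'p) module_scheme
      \<Rightarrow> ('k, 'x, 'q) module_scheme \<Rightarrow> ('v \<Rightarrow> 'w \<Rightarrow> 'x) \<Rightarrow> ('v \<times> 'w \<Rightarrow> 'k) set \<Rightarrow> 'x"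
  where "tensor_lift K V W X B =
    (THE h. h \<in> extensional (carrier (tensor K V W)) \<and> linear_map K (tensor K V W) X h \<and>
       (\<forall>v\<in>carrier V. \<forall>w\<in>carrier W. h (pure_tensor K V W v w) = B v w))"


subsection \<open>The universal property\<close>

lemma free_space_submodule:
  assumes "field K"
  shows "submodule K {f \<in> S \<rightarrow>\<^sub>E carrier K. finite {s \<in> S. f s \<noteq> \<zero>\<^bsub>K\<^esub>}} (ring.func_space K S)"
proof -
  interpret field K by fact
  have *: "finite {s \<in> S. f s \<oplus>\<^bsub>K\<^esub> g s \<noteq> \<zero>\<^bsub>K\<^esub>}"
    if "finite {s \<in> S. f s \<noteq> \<zero>\<^bsub>K\<^esub>}" "finite {s \<in> S. g s \<noteq> \<zero>\<^bsub>K\<^esub>}" for f g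
    by (rule finite_subset[OF _ finite_UnI[OF that]]) auto
  have **: "finite {s \<in> S. c \<otimes>\<^bsub>K\<^esub> f s \<noteq> \<zero>\<^bsub>K\<^esub>}"
    if "finite {s \<in> S. f s \<noteq> \<zero>\<^bsub>K\<^esub>}" "c \<in> carrier K" for f c
    by (rule finite_subset[OF _ that(1)]) (use that in auto)
  show ?thesis
    by (rule submodule.intro, rule func_space_is_module)
       (auto simp: func_space_def PiE_iff extensional_def * ** cong: conj_cong)
qed

lemma vectorspace_free_space:
  assumes "field K" shows "vectorspace K (free_space K S)"
proof -
  interpret field K by fact
  interpret F: module K "ring.func_space K S" by (rule func_space_is_module)
  show ?thesis unfolding free_space_def
    by (intro vectorspace.intro F.submodule_is_module free_space_submodule assms)
qed

lemma abelian_subgroup_submodule: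
  assumes "submodule K N M" shows "abelian_subgroup N M"
proof -
  interpret submodule K N M by fact
  interpret M: module K M by (rule module)
  have "\<ominus>\<^bsub>M\<^esub> x \<in> N" if "x \<in> N" for x
    using that subset smult_closed[of "\<ominus>\<^bsub>K\<^esub> \<one>\<^bsub>K\<^esub>" x] M.smult_minus_1[of x]
    by (metis M.R.add.inv_closed M.R.one_closed subsetD)
  then have "additive_subgroup N M"
    by (intro additive_subgroup.intro subgroup.intro)
       (use subset in \<open>auto simp: a_inv_def[symmetric]\<close>)
  then show ?thesis
    by (intro abelian_subgroupI3 M.abelian_group_axioms)
qed

lemma quotient_smult:
  assumes "submodule K N M" "a \<in> carrier K" "x \<in> carrier M"
  shows "a \<odot>\<^bsub>quotient_module M N\<^esub> (N +>\<^bsub>M\<^esub> x) = N +>\<^bsub>M\<^esub> (a \<odot>\<^bsub>M\<^esub> x)"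
proof -
  interpret submodule K N M by fact
  interpret M: module K M by (rule module)
  interpret abelian_subgroup N M by (rule abelian_subgroup_submodule) fact
  have "N +>\<^bsub>M\<^esub> (a \<odot>\<^bsub>M\<^esub> y) = N +>\<^bsub>M\<^esub> (a \<odot>\<^bsub>M\<^esub> x)" if "y \<in> N +>\<^bsub>M\<^esub> x" for y
  proof -
    obtain n where n: "n \<in> N" "y = n \<oplus>\<^bsub>M\<^esub> x"
      using \<open>y \<in> _\<close> unfolding a_r_coset_def'[of M N x] by blast
    have nM: "n \<in> carrier M" using n subset by auto
    have "a \<odot>\<^bsub>M\<^esub> y = (a \<odot>\<^bsub>M\<^esub> n) \<oplus>\<^bsub>M\<^esub> (a \<odot>\<^bsub>M\<^esub> x)"
      using n nM assms by (simp add: M.smult_r_distr)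
    then have "a \<odot>\<^bsub>M\<^esub> y \<in> N +>\<^bsub>M\<^esub> (a \<odot>\<^bsub>M\<^esub> x)"
      unfolding a_r_coset_def'[of M N] using n smult_closed[OF assms(2), of n] by auto
    then show ?thesis using a_repr_independence' assms by auto
  qed
  moreover have "x \<in> N +>\<^bsub>M\<^esub> x" using a_rcos_self assms by auto
  ultimately have "(\<Union>y\<in>N +>\<^bsub>M\<^esub> x. N +>\<^bsub>M\<^esub> (a \<odot>\<^bsub>M\<^esub> y)) = N +>\<^bsub>M\<^esub> (a \<odot>\<^bsub>M\<^esub> x)"
    by (intro SUP_eq_const) blast+
  then show ?thesis by (simp add: quotient_module_def)
qed

lemma
  assumes "submodule K N M"
  shows quotient_carrier: "carrier (quotient_module M N) = (\<lambda>x. N +>\<^bsub>M\<^esub> x) ` carrier M"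
    and quotient_add: "\<lbrakk>x \<in> carrier M; y \<in> carrier M\<rbrakk> \<Longrightarrow>
      (N +>\<^bsub>M\<^esub> x) \<oplus>\<^bsub>quotient_module M N\<^esub> (N +>\<^bsub>M\<^esub> y) = N +>\<^bsub>M\<^esub> (x \<oplus>\<^bsub>M\<^esub> y)"
    and quotient_zero: "\<zero>\<^bsub>quotient_module M N\<^esub> = N +>\<^bsub>M\<^esub> \<zero>\<^bsub>M\<^esub>"
proof -
  interpret submodule K N M by fact
  interpret M: module K M by (rule module)
  interpret abelian_subgroup N M by (rule abelian_subgroup_submodule) fact
  show "carrier (quotient_module M N) = (\<lambda>x. N +>\<^bsub>M\<^esub> x) ` carrier M"
    by (auto simp: quotient_module_def A_RCOSETS_def')
  show "(N +>\<^bsub>M\<^esub> x) \<oplus>\<^bsub>quotient_module M N\<^esub> (N +>\<^bsub>M\<^esub> y) = N +>\<^bsub>M\<^esub> (x \<oplus>\<^bsub>M\<^esub> y)"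
    if "x \<in> carrier M" "y \<in> carrier M"
    using a_rcos_sum that by (simp add: quotient_module_def)
  show "\<zero>\<^bsub>quotient_module M N\<^esub> = N +>\<^bsub>M\<^esub> \<zero>\<^bsub>M\<^esub>"
    using a_rcos_const[of "\<zero>\<^bsub>M\<^esub>"] by (simp add: quotient_module_def)
qed

lemma module_quotient_module:
  assumes "submodule K N M" shows "module K (quotient_module M N)"
proof -
  interpret submodule K N M by fact
  interpret M: module K M by (rule module)
  note q = quotient_carrier[OF assms] quotient_add[OF assms] quotient_zero[OF assms]
    quotient_smult[OF assms]
  show ?thesis
  proof (rule module_criteria)
    show "\<forall>v\<in>carrier (quotient_module M N). \<exists>neg_v\<in>carrier (quotient_module M N).
       v \<oplus>\<^bsub>quotient_module M N\<^esub> neg_v = \<zero>\<^bsub>quotient_module M N\<^esub>"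
    proof
      fix v assume "v \<in> carrier (quotient_module M N)"
      then obtain x where x: "x \<in> carrier M" "v = N +>\<^bsub>M\<^esub> x" by (auto simp: q)
      then have "v \<oplus>\<^bsub>quotient_module M N\<^esub> (N +>\<^bsub>M\<^esub> (\<ominus>\<^bsub>M\<^esub> x)) = \<zero>\<^bsub>quotient_module M N\<^esub>"
        by (simp add: q M.M.r_neg)
      then show "\<exists>neg_v\<in>carrier (quotient_module M N).
          v \<oplus>\<^bsub>quotient_module M N\<^esub> neg_v = \<zero>\<^bsub>quotient_module M N\<^esub>"
        using x by (auto simp: q)
    qed
  qed (auto simp: q M.R.cring_axioms M.M.a_ac M.smult_assoc1 M.smult_l_distr
         M.smult_r_distr)
qed


lemma
  assumes "field K"
  shows free_carrier: "f \<in> carrier (free_space K S) \<longleftrightarrow>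
      f \<in> S \<rightarrow>\<^sub>E carrier K \<and> finite {s \<in> S. f s \<noteq> \<zero>\<^bsub>K\<^esub>}"
    and free_add: "f \<oplus>\<^bsub>free_space K S\<^esub> g = (\<lambda>s\<in>S. f s \<oplus>\<^bsub>K\<^esub> g s)"
    and free_smult: "a \<odot>\<^bsub>free_space K S\<^esub> f = (\<lambda>s\<in>S. a \<otimes>\<^bsub>K\<^esub> f s)"
    and free_zero: "\<zero>\<^bsub>free_space K S\<^esub> = (\<lambda>s\<in>S. \<zero>\<^bsub>K\<^esub>)"
proof -
  interpret field K by fact
  show "f \<in> carrier (free_space K S) \<longleftrightarrow>
      f \<in> S \<rightarrow>\<^sub>E carrier K \<and> finite {s \<in> S. f s \<noteq> \<zero>\<^bsub>K\<^esub>}"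
    "f \<oplus>\<^bsub>free_space K S\<^esub> g = (\<lambda>s\<in>S. f s \<oplus>\<^bsub>K\<^esub> g s)"
    "a \<odot>\<^bsub>free_space K S\<^esub> f = (\<lambda>s\<in>S. a \<otimes>\<^bsub>K\<^esub> f s)"
    "\<zero>\<^bsub>free_space K S\<^esub> = (\<lambda>s\<in>S. \<zero>\<^bsub>K\<^esub>)"
    by (auto simp: free_space_def func_space_def)
qed

lemma free_gen_carrier:
  assumes "field K"
  shows "free_gen K S s \<in> carrier (free_space K S)"
proof -
  interpret field K by fact
  have "finite {t \<in> S. free_gen K S s t \<noteq> \<zero>\<^bsub>K\<^esub>}"
    by (rule finite_subset[of _ "{s}"]) (auto simp: free_gen_def)
  then show ?thesis by (auto simp: free_carrier[OF assms] free_gen_def)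
qed

lemma free_space_induct [consumes 2, case_names zero add]:
  assumes "field K" and "f \<in> carrier (free_space K S)"
    and "P \<zero>\<^bsub>free_space K S\<^esub>"
    and step: "\<And>a s g. \<lbrakk>a \<in> carrier K; s \<in> S; g \<in> carrier (free_space K S); P g\<rbrakk>
      \<Longrightarrow> P (a \<odot>\<^bsub>free_space K S\<^esub> free_gen K S s \<oplus>\<^bsub>free_space K S\<^esub> g)"
  shows "P f"
proof -
  interpret field K by fact
  have "finite A \<Longrightarrow> \<forall>f. f \<in> carrier (free_space K S) \<and> {s \<in> S. f s \<noteq> \<zero>\<^bsub>K\<^esub>} = A \<longrightarrow> P f" for A
  proof (induction A rule: finite_induct)
    case empty
    have "f = \<zero>\<^bsub>free_space K S\<^esub>"
      if "f \<in> carrier (free_space K S)" "{s \<in> S. f s \<noteq> \<zero>\<^bsub>K\<^esub>} = {}" for f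
      using that by (auto simp: free_carrier free_zero assms(1) PiE_iff extensional_def fun_eq_iff)
    then show ?case using assms(3) by blast
  next
    case (insert t A)
    show ?case
    proof (intro allI impI, elim conjE)
      fix f assume f: "f \<in> carrier (free_space K S)" "{s \<in> S. f s \<noteq> \<zero>\<^bsub>K\<^esub>} = insert t A"
      define g where "g = (\<lambda>s\<in>S. if s = t then \<zero>\<^bsub>K\<^esub> else f s)"
      have t: "t \<in> S" using f(2) by auto
      have fE: "f \<in> S \<rightarrow>\<^sub>E carrier K" using f(1) by (simp add: free_carrier assms(1))
      have ft: "f t \<in> carrier K" using fE t by auto
      have gA: "{s \<in> S. g s \<noteq> \<zero>\<^bsub>K\<^esub>} = A" using f(2) insert.hyps by (auto simp: g_def)
      have g: "g \<in> carrier (free_space K S)"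
        unfolding free_carrier[OF assms(1)] gA using fE insert.hyps by (auto simp: g_def)
      have "f = f t \<odot>\<^bsub>free_space K S\<^esub> free_gen K S t \<oplus>\<^bsub>free_space K S\<^esub> g"
        using fE t ft
        by (auto simp: free_add free_smult assms(1) g_def free_gen_def fun_eq_iff PiE_iff
              extensional_def)
      moreover have "P g" using insert.IH g gA by blast
      ultimately show "P f" using step[OF ft t g] by simp
    qed
  qed
  from this[of "{s \<in> S. f s \<noteq> \<zero>\<^bsub>K\<^esub>}"] assms(2) show ?thesis
    by (auto simp: free_carrier assms(1))
qed

definition free_eval :: "('k, 'x, 'q) module_scheme \<Rightarrow> ('k, 'm) ring_scheme \<Rightarrow> 's set \<Rightarrow>
    ('s \<Rightarrow> 'x) \<Rightarrow> ('s \<Rightarrow> 'k) \<Rightarrow> 'x"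
  where "free_eval X K S b f = (\<Oplus>\<^bsub>X\<^esub>s\<in>{s \<in> S. f s \<noteq> \<zero>\<^bsub>K\<^esub>}. f s \<odot>\<^bsub>X\<^esub> b s)"

lemma free_eval_superset:
  assumes "vectorspace K X" "b \<in> S \<rightarrow> carrier X" "f \<in> S \<rightarrow> carrier K"
    and "finite A" "{s \<in> S. f s \<noteq> \<zero>\<^bsub>K\<^esub>} \<subseteq> A" "A \<subseteq> S"
  shows "free_eval X K S b f = (\<Oplus>\<^bsub>X\<^esub>s\<in>A. f s \<odot>\<^bsub>X\<^esub> b s)"
proof -
  interpret X: vectorspace K X by fact
  show ?thesis unfolding free_eval_def
  proof (rule X.add.finprod_mono_neutral_cong_left)
    show "f i \<odot>\<^bsub>X\<^esub> b i = \<zero>\<^bsub>X\<^esub>" if "i \<in> A - {s \<in> S. f s \<noteq> \<zero>\<^bsub>K\<^esub>}" for i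
    proof -
      have "f i = \<zero>\<^bsub>K\<^esub>" "b i \<in> carrier X" using that assms by auto
      then show ?thesis by simp
    qed
    show "(\<lambda>s. f s \<odot>\<^bsub>X\<^esub> b s) \<in> A \<rightarrow> carrier X"
      using assms by (auto intro!: X.smult_closed)
  qed (use assms in auto)
qed

lemma linear_free_eval:
  assumes "vectorspace K X" "b \<in> S \<rightarrow> carrier X"
  shows "linear_map K (free_space K S) X (free_eval X K S b)"
proof -
  interpret X: vectorspace K X by fact
  have K: "field K" ..
  interpret F: vectorspace K "free_space K S" by (rule vectorspace_free_space) (rule K)
  have closed: "f s \<odot>\<^bsub>X\<^esub> b s \<in> carrier X" if "f \<in> carrier (free_space K S)" "s \<in> S" for f s
    using that assms(2) by (auto simp: free_carrier[OF K] intro!: X.smult_closed)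
  have "free_eval X K S b \<in> module_hom K (free_space K S) X"
    unfolding module_hom_def
  proof (intro CollectI conjI allI impI funcsetI; (elim conjE)?)
    fix f assume f: "f \<in> carrier (free_space K S)"
    show "free_eval X K S b f \<in> carrier X"
      unfolding free_eval_def using closed[OF f] by (auto intro!: X.finsum_closed)
  next
    fix f g assume f: "f \<in> carrier (free_space K S)" and g: "g \<in> carrier (free_space K S)"
    let ?A = "{s \<in> S. f s \<noteq> \<zero>\<^bsub>K\<^esub>} \<union> {s \<in> S. g s \<noteq> \<zero>\<^bsub>K\<^esub>}"
    have fin: "finite ?A" using f g by (auto simp: free_carrier[OF K])
    have S: "f \<in> S \<rightarrow> carrier K" "g \<in> S \<rightarrow> carrier K" using f g by (auto simp: free_carrier[OF K])
    have fg: "f \<oplus>\<^bsub>free_space K S\<^esub> g \<in> S \<rightarrow> carrier K" using S by (auto simp: free_add[OF K])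
    have "free_eval X K S b (f \<oplus>\<^bsub>free_space K S\<^esub> g) =
        (\<Oplus>\<^bsub>X\<^esub>s\<in>?A. (f \<oplus>\<^bsub>free_space K S\<^esub> g) s \<odot>\<^bsub>X\<^esub> b s)"
      by (rule free_eval_superset[OF assms fg fin]) (auto simp: free_add[OF K])
    also have "\<dots> = (\<Oplus>\<^bsub>X\<^esub>s\<in>?A. f s \<odot>\<^bsub>X\<^esub> b s \<oplus>\<^bsub>X\<^esub> g s \<odot>\<^bsub>X\<^esub> b s)"
    proof (rule X.finsum_cong')
      show "(f \<oplus>\<^bsub>free_space K S\<^esub> g) s \<odot>\<^bsub>X\<^esub> b s = f s \<odot>\<^bsub>X\<^esub> b s \<oplus>\<^bsub>X\<^esub> g s \<odot>\<^bsub>X\<^esub> b s"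
        if "s \<in> ?A" for s
      proof -
        have "s \<in> S" using that by auto
        then show ?thesis
          using S assms(2) by (auto simp: free_add[OF K] intro!: X.smult_l_distr)
      qed
    qed (use closed[OF f] closed[OF g] in \<open>auto\<close>)
    also have "\<dots> = (\<Oplus>\<^bsub>X\<^esub>s\<in>?A. f s \<odot>\<^bsub>X\<^esub> b s) \<oplus>\<^bsub>X\<^esub> (\<Oplus>\<^bsub>X\<^esub>s\<in>?A. g s \<odot>\<^bsub>X\<^esub> b s)"
      by (rule X.finsum_addf) (use closed[OF f] closed[OF g] in auto)
    also have "(\<Oplus>\<^bsub>X\<^esub>s\<in>?A. f s \<odot>\<^bsub>X\<^esub> b s) = free_eval X K S b f"
      by (rule free_eval_superset[OF assms S(1) fin, symmetric]) auto
    also have "(\<Oplus>\<^bsub>X\<^esub>s\<in>?A. g s \<odot>\<^bsub>X\<^esub> b s) = free_eval X K S b g"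
      by (rule free_eval_superset[OF assms S(2) fin, symmetric]) auto
    finally show "free_eval X K S b (f \<oplus>\<^bsub>free_space K S\<^esub> g) =
      free_eval X K S b f \<oplus>\<^bsub>X\<^esub> free_eval X K S b g" .
  next
    fix a f assume a: "a \<in> carrier K" and f: "f \<in> carrier (free_space K S)"
    let ?A = "{s \<in> S. f s \<noteq> \<zero>\<^bsub>K\<^esub>}"
    have fin: "finite ?A" using f by (auto simp: free_carrier[OF K])
    have S: "f \<in> S \<rightarrow> carrier K" using f by (auto simp: free_carrier[OF K])
    have af: "a \<odot>\<^bsub>free_space K S\<^esub> f \<in> S \<rightarrow> carrier K" using S a by (auto simp: free_smult[OF K])
    have "free_eval X K S b (a \<odot>\<^bsub>free_space K S\<^esub> f) =
        (\<Oplus>\<^bsub>X\<^esub>s\<in>?A. (a \<odot>\<^bsub>free_space K S\<^esub> f) s \<odot>\<^bsub>X\<^esub> b s)"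
      by (rule free_eval_superset[OF assms af fin]) (use a in \<open>auto simp: free_smult[OF K]\<close>)
    also have "\<dots> = (\<Oplus>\<^bsub>X\<^esub>s\<in>?A. a \<odot>\<^bsub>X\<^esub> (f s \<odot>\<^bsub>X\<^esub> b s))"
    proof (rule X.finsum_cong')
      show "(a \<odot>\<^bsub>free_space K S\<^esub> f) s \<odot>\<^bsub>X\<^esub> b s = a \<odot>\<^bsub>X\<^esub> (f s \<odot>\<^bsub>X\<^esub> b s)"
        if "s \<in> ?A" for s
      proof -
        have "s \<in> S" using that by auto
        then show ?thesis
          using S assms(2) a by (auto simp: free_smult[OF K] intro!: X.smult_assoc1)
      qed
    qed (use closed[OF f] a in auto)
    also have "\<dots> = a \<odot>\<^bsub>X\<^esub> (\<Oplus>\<^bsub>X\<^esub>s\<in>?A. f s \<odot>\<^bsub>X\<^esub> b s)"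
      by (rule X.finsum_smult[symmetric]) (use closed[OF f] a in auto)
    finally show "free_eval X K S b (a \<odot>\<^bsub>free_space K S\<^esub> f) = a \<odot>\<^bsub>X\<^esub> free_eval X K S b f"
      by (simp add: free_eval_def)
  qed
  then show ?thesis
    by (intro linear_map.intro mod_hom.intro mod_hom_axioms.intro assms(1)
        F.vectorspace_axioms F.module_axioms X.module_axioms)
qed

lemma free_eval_gen:
  assumes "vectorspace K X" "b \<in> S \<rightarrow> carrier X" "s \<in> S"
  shows "free_eval X K S b (free_gen K S s) = b s"
proof -
  interpret X: vectorspace K X by fact
  have "{t \<in> S. free_gen K S s t \<noteq> \<zero>\<^bsub>K\<^esub>} = {s}" using assms(3) by (auto simp: free_gen_def)
  moreover have "b s \<in> carrier X" using assms by auto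
  ultimately show ?thesis using assms(3) by (simp add: free_eval_def free_gen_def)
qed

lemma relators_subset:
  assumes "vectorspace K V" "vectorspace K W"
  shows "bilinear_relators K V W \<subseteq> carrier (free_space K (carrier V \<times> carrier W))"
proof -
  interpret V: vectorspace K V by fact
  have K: "field K" ..
  interpret F: vectorspace K "free_space K (carrier V \<times> carrier W)"
    by (rule vectorspace_free_space) (rule K)
  show ?thesis
    unfolding bilinear_relators_def Let_def using free_gen_carrier[OF K]
    by (auto intro!: F.minus_closed F.M.add.m_closed F.smult_closed)
qed

lemma submodule_bilinear_submodule:
  assumes "vectorspace K V" "vectorspace K W"
  shows "submodule K (bilinear_submodule K V W) (free_space K (carrier V \<times> carrier W))"
proof -
  interpret V: vectorspace K V by fact
  have K: "field K" ..
  interpret F: vectorspace K "free_space K (carrier V \<times> carrier W)"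
    by (rule vectorspace_free_space) (rule K)
  show ?thesis unfolding bilinear_submodule_def
    by (rule F.span_is_submodule) (rule relators_subset[OF assms])
qed

lemma vectorspace_tensor:
  assumes "vectorspace K V" "vectorspace K W"
  shows "vectorspace K (tensor K V W)"
  unfolding tensor_def
  by (intro vectorspace.intro module_quotient_module submodule_bilinear_submodule assms)
     (rule vectorspace.axioms[OF assms(1)])

lemma linear_mapD:
  assumes "linear_map K V W f"
  shows "v \<in> carrier V \<Longrightarrow> f v \<in> carrier W"
    and "\<lbrakk>v \<in> carrier V; v' \<in> carrier V\<rbrakk> \<Longrightarrow> f (v \<oplus>\<^bsub>V\<^esub> v') = f v \<oplus>\<^bsub>W\<^esub> f v'"
    and "\<lbrakk>a \<in> carrier K; v \<in> carrier V\<rbrakk> \<Longrightarrow> f (a \<odot>\<^bsub>V\<^esub> v) = a \<odot>\<^bsub>W\<^esub> f v"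
    and "f \<zero>\<^bsub>V\<^esub> = \<zero>\<^bsub>W\<^esub>"
proof -
  interpret linear_map K V W f by fact
  show "v \<in> carrier V \<Longrightarrow> f v \<in> carrier W"
    "\<lbrakk>v \<in> carrier V; v' \<in> carrier V\<rbrakk> \<Longrightarrow> f (v \<oplus>\<^bsub>V\<^esub> v') = f v \<oplus>\<^bsub>W\<^esub> f v'"
    "\<lbrakk>a \<in> carrier K; v \<in> carrier V\<rbrakk> \<Longrightarrow> f (a \<odot>\<^bsub>V\<^esub> v) = a \<odot>\<^bsub>W\<^esub> f v"
    "f \<zero>\<^bsub>V\<^esub> = \<zero>\<^bsub>W\<^esub>" by auto
qed

lemma linear_mapI:
  assumes "vectorspace K V" "vectorspace K W"
    and "\<And>v. v \<in> carrier V \<Longrightarrow> f v \<in> carrier W"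
    and "\<And>v v'. \<lbrakk>v \<in> carrier V; v' \<in> carrier V\<rbrakk> \<Longrightarrow> f (v \<oplus>\<^bsub>V\<^esub> v') = f v \<oplus>\<^bsub>W\<^esub> f v'"
    and "\<And>a v. \<lbrakk>a \<in> carrier K; v \<in> carrier V\<rbrakk> \<Longrightarrow> f (a \<odot>\<^bsub>V\<^esub> v) = a \<odot>\<^bsub>W\<^esub> f v"
  shows "linear_map K V W f"
proof -
  interpret V: vectorspace K V by fact
  interpret W: vectorspace K W by fact
  show ?thesis
    by (intro linear_map.intro mod_hom.intro mod_hom_axioms.intro V.vectorspace_axioms
          W.vectorspace_axioms V.module_axioms W.module_axioms)
       (auto simp: module_hom_def assms)
qed

lemma bilinear_pure_tensor:
  assumes V: "vectorspace K V" and W: "vectorspace K W"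
  shows "bilinear_map K V W (tensor K V W) (pure_tensor K V W)"
proof -
  interpret V: vectorspace K V by fact
  interpret W: vectorspace K W by fact
  have K: "field K" ..
  let ?S = "carrier V \<times> carrier W"
  let ?F = "free_space K ?S"
  let ?N = "bilinear_submodule K V W"
  interpret F: vectorspace K ?F by (rule vectorspace_free_space) (rule K)
  note sub = submodule_bilinear_submodule[OF V W]
  interpret N: abelian_subgroup ?N ?F by (rule abelian_subgroup_submodule) (rule sub)
  note q = quotient_carrier[OF sub] quotient_add[OF sub] quotient_smult[OF sub]
  note gen = free_gen_carrier[OF K, of ?S]
  have rel: "r \<in> ?N" if "r \<in> bilinear_relators K V W" for r
    using F.in_own_span[OF relators_subset[OF V W]] that
    unfolding bilinear_submodule_def by blast
  have eq: "?N +>\<^bsub>?F\<^esub> x = ?N +>\<^bsub>?F\<^esub> y"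
    if "x \<in> carrier ?F" "y \<in> carrier ?F" "x \<ominus>\<^bsub>?F\<^esub> y \<in> ?N" for x y
    using that N.a_rcos_module_rev[of y x] N.a_repr_independence' unfolding a_minus_def by metis
  have cl: "pure_tensor K V W v w \<in> carrier (tensor K V W)" for v w
    using gen by (auto simp: pure_tensor_def tensor_def q)
  show ?thesis
    unfolding bilinear_map_def
  proof (intro conjI ballI linear_mapI V W vectorspace_tensor cl)
    fix v w w' assume *: "v \<in> carrier V" "w \<in> carrier W" "w' \<in> carrier W"
    show "pure_tensor K V W v (w \<oplus>\<^bsub>W\<^esub> w') =
        pure_tensor K V W v w \<oplus>\<^bsub>tensor K V W\<^esub> pure_tensor K V W v w'"
      unfolding pure_tensor_def tensor_def q(2)[OF gen gen]
      by (intro eq gen F.M.add.m_closed rel)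
         (unfold bilinear_relators_def Let_def, rule UnI1, rule UnI1, rule UnI2, use * in blast)
  next
    fix v v' w assume *: "v \<in> carrier V" "v' \<in> carrier V" "w \<in> carrier W"
    show "pure_tensor K V W (v \<oplus>\<^bsub>V\<^esub> v') w =
        pure_tensor K V W v w \<oplus>\<^bsub>tensor K V W\<^esub> pure_tensor K V W v' w"
      unfolding pure_tensor_def tensor_def q(2)[OF gen gen]
      by (intro eq gen F.M.add.m_closed rel)
         (unfold bilinear_relators_def Let_def, rule UnI1, rule UnI1, rule UnI1, use * in blast)
  next
    fix a v w assume *: "a \<in> carrier K" "v \<in> carrier V" "w \<in> carrier W"
    show "pure_tensor K V W v (a \<odot>\<^bsub>W\<^esub> w) = a \<odot>\<^bsub>tensor K V W\<^esub> pure_tensor K V W v w"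
      unfolding pure_tensor_def tensor_def q(3)[OF *(1) gen]
      by (intro eq gen F.smult_closed rel *)
         (unfold bilinear_relators_def Let_def, rule UnI2, use * in blast)
  next
    fix w a v assume *: "w \<in> carrier W" "a \<in> carrier K" "v \<in> carrier V"
    show "pure_tensor K V W (a \<odot>\<^bsub>V\<^esub> v) w = a \<odot>\<^bsub>tensor K V W\<^esub> pure_tensor K V W v w"
      unfolding pure_tensor_def tensor_def q(3)[OF *(2) gen]
      by (intro eq gen F.smult_closed rel *)
         (unfold bilinear_relators_def Let_def, rule UnI1, rule UnI2, use * in blast)
  qed
qed

lemma tensor_induct [consumes 3, case_names zero add]:
  assumes V: "vectorspace K V" and W: "vectorspace K W" and t: "t \<in> carrier (tensor K V W)"
    and zero: "P \<zero>\<^bsub>tensor K V W\<^esub>"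
    and add: "\<And>v w t. \<lbrakk>v \<in> carrier V; w \<in> carrier W; t \<in> carrier (tensor K V W); P t\<rbrakk>
      \<Longrightarrow> P (pure_tensor K V W v w \<oplus>\<^bsub>tensor K V W\<^esub> t)"
  shows "P t"
proof -
  interpret V: vectorspace K V by fact
  interpret W: vectorspace K W by fact
  have K: "field K" ..
  let ?S = "carrier V \<times> carrier W"
  let ?F = "free_space K ?S"
  let ?N = "bilinear_submodule K V W"
  interpret F: vectorspace K ?F by (rule vectorspace_free_space) (rule K)
  note sub = submodule_bilinear_submodule[OF V W]
  note q = quotient_carrier[OF sub] quotient_add[OF sub] quotient_smult[OF sub] quotient_zero[OF sub]
  obtain f where f: "f \<in> carrier ?F" "t = ?N +>\<^bsub>?F\<^esub> f"
    using t by (auto simp: tensor_def q)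
  have "P (?N +>\<^bsub>?F\<^esub> f)"
    using K f(1)
  proof (induction rule: free_space_induct)
    case zero
    then show ?case using assms(4) by (simp add: tensor_def q)
  next
    case (add a s g)
    obtain v w where s: "s = (v, w)" "v \<in> carrier V" "w \<in> carrier W" using add by auto
    have "?N +>\<^bsub>?F\<^esub> (a \<odot>\<^bsub>?F\<^esub> free_gen K ?S s \<oplus>\<^bsub>?F\<^esub> g) =
      a \<odot>\<^bsub>tensor K V W\<^esub> pure_tensor K V W v w \<oplus>\<^bsub>tensor K V W\<^esub> (?N +>\<^bsub>?F\<^esub> g)"
      using add free_gen_carrier[OF K, of ?S]
      by (simp add: pure_tensor_def tensor_def q s F.smult_closed)
    also have "a \<odot>\<^bsub>tensor K V W\<^esub> pure_tensor K V W v w = pure_tensor K V W (a \<odot>\<^bsub>V\<^esub> v) w"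
      using bilinear_pure_tensor[OF V W] s add linear_mapD(3)[of K V "tensor K V W"]
      unfolding bilinear_map_def by metis
    finally show ?case
      using assms(5)[of "a \<odot>\<^bsub>V\<^esub> v" w "?N +>\<^bsub>?F\<^esub> g"] add s by (simp add: tensor_def q)
  qed
  then show ?thesis using f by simp
qed

lemma tensor_universal:
  assumes V: "vectorspace K V" and W: "vectorspace K W" and X: "vectorspace K X"
    and B: "bilinear_map K V W X B"
  shows "\<exists>!h. h \<in> extensional (carrier (tensor K V W)) \<and> linear_map K (tensor K V W) X h \<and>
    (\<forall>v\<in>carrier V. \<forall>w\<in>carrier W. h (pure_tensor K V W v w) = B v w)"
proof -
  interpret V: vectorspace K V by fact
  interpret W: vectorspace K W by fact
  interpret X: vectorspace K X by fact
  have K: "field K" ..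
  let ?S = "carrier V \<times> carrier W"
  let ?F = "free_space K ?S"
  let ?N = "bilinear_submodule K V W"
  let ?T = "tensor K V W"
  interpret F: vectorspace K ?F by (rule vectorspace_free_space) (rule K)
  note sub = submodule_bilinear_submodule[OF V W]
  interpret N: abelian_subgroup ?N ?F by (rule abelian_subgroup_submodule) (rule sub)
  note q = quotient_carrier[OF sub] quotient_add[OF sub] quotient_smult[OF sub]
  note gen = free_gen_carrier[OF K, of ?S]
  let ?b = "\<lambda>(v, w). B v w"
  have b1: "linear_map K W X (B v)" if "v \<in> carrier V" for v
    using B that by (auto simp: bilinear_map_def)
  have b2: "linear_map K V X (\<lambda>v. B v w)" if "w \<in> carrier W" for w
    using B that by (auto simp: bilinear_map_def)
  have b: "?b \<in> ?S \<rightarrow> carrier X" using linear_mapD(1)[OF b1] by auto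
  interpret E: linear_map K ?F X "free_eval X K ?S ?b"
    by (rule linear_free_eval[OF X b])
  let ?e = "free_eval X K ?S ?b"
  have eg: "?e (free_gen K ?S (v, w)) = B v w" if "v \<in> carrier V" "w \<in> carrier W" for v w
    using free_eval_gen[OF X b, of "(v, w)"] that by simp
  have "bilinear_relators K V W \<subseteq> E.ker"
    unfolding bilinear_relators_def Let_def E.ker_def
    using gen linear_mapD[OF b1] linear_mapD[OF b2]
    by (auto simp: eg F.smult_closed a_minus_def X.M.r_neg)
  then have "?N \<subseteq> E.ker"
    unfolding bilinear_submodule_def by (rule F.span_is_subset) (rule E.ker_is_submodule)
  then have N0: "?e n = \<zero>\<^bsub>X\<^esub>" if "n \<in> ?N" for n using that by (auto simp: E.ker_def)
  have const: "?e g = ?e f" if f: "f \<in> carrier ?F" and g: "g \<in> ?N +>\<^bsub>?F\<^esub> f" for f g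
  proof -
    obtain n where n: "n \<in> ?N" "g = n \<oplus>\<^bsub>?F\<^esub> f"
      using g unfolding a_r_coset_def'[of ?F ?N f] by blast
    have "n \<in> carrier ?F" using n(1) N.a_subset by blast
    then show ?thesis using f N0[OF n(1)] E.f_im[OF f] unfolding n(2) by (simp only: E.f_add X.M.l_zero)
  qed
  define h where "h = (\<lambda>t\<in>carrier ?T. ?e (SOME f. f \<in> t))"
  have h: "h (?N +>\<^bsub>?F\<^esub> f) = ?e f" if "f \<in> carrier ?F" for f
  proof -
    have "(SOME g. g \<in> ?N +>\<^bsub>?F\<^esub> f) \<in> ?N +>\<^bsub>?F\<^esub> f"
      using N.a_rcos_self[OF that] by (rule someI[of "\<lambda>g. g \<in> ?N +>\<^bsub>?F\<^esub> f"])
    then show ?thesis using const[OF that] that by (simp add: h_def tensor_def q)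
  qed
  have lin: "linear_map K ?T X h"
  proof (rule linear_mapI[OF vectorspace_tensor[OF V W] X])
    show "h t \<in> carrier X" if "t \<in> carrier ?T" for t
      using that h by (auto simp: tensor_def q)
    show "h (s \<oplus>\<^bsub>?T\<^esub> t) = h s \<oplus>\<^bsub>X\<^esub> h t" if "s \<in> carrier ?T" "t \<in> carrier ?T" for s t
      using that h by (auto simp: tensor_def q)
    show "h (a \<odot>\<^bsub>?T\<^esub> t) = a \<odot>\<^bsub>X\<^esub> h t" if "a \<in> carrier K" "t \<in> carrier ?T" for a t
      using that h by (auto simp: tensor_def q F.smult_closed)
  qed
  show ?thesis
  proof (rule ex1I[of _ h], intro conjI ballI lin)
    show "h \<in> extensional (carrier ?T)" by (simp add: h_def)
    show "h (pure_tensor K V W v w) = B v w" if "v \<in> carrier V" "w \<in> carrier W" for v w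
      using that h[OF gen] eg by (simp add: pure_tensor_def)
  next
    fix g assume g: "g \<in> extensional (carrier ?T) \<and> linear_map K ?T X g \<and>
      (\<forall>v\<in>carrier V. \<forall>w\<in>carrier W. g (pure_tensor K V W v w) = B v w)"
    have pc: "pure_tensor K V W v w \<in> carrier ?T" if "v \<in> carrier V" "w \<in> carrier W" for v w
      using gen by (auto simp: pure_tensor_def tensor_def q)
    have "g t = h t" if "t \<in> carrier ?T" for t
      using V W that
    proof (induction rule: tensor_induct)
      case zero
      then show ?case using linear_mapD(4)[OF lin] g linear_mapD(4)[of K ?T X g] by auto
    next
      case (add v w t)
      then show ?case
        using linear_mapD(2)[OF lin pc, of v w t] g linear_mapD(2)[of K ?T X g, OF _ pc, of v w t]
          h[OF gen] eg by (auto simp: pure_tensor_def)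
    qed
    then show "g = h" using g by (auto simp: h_def intro!: extensionalityI[of _ "carrier ?T"])
  qed
qed

lemma
  assumes "vectorspace K V" "vectorspace K W" "vectorspace K X" "bilinear_map K V W X B"
  shows linear_tensor_lift: "linear_map K (tensor K V W) X (tensor_lift K V W X B)"
    and tensor_lift_pure: "\<lbrakk>v \<in> carrier V; w \<in> carrier W\<rbrakk> \<Longrightarrow>
      tensor_lift K V W X B (pure_tensor K V W v w) = B v w"
  using theI'[OF tensor_universal[OF assms], folded tensor_lift_def] by blast+

section \<open>Maps between tensor products\<close>

definition tensor_map ::
    "('k, 'm) ring_scheme \<Rightarrow> ('k, 'v, 'n) module_scheme \<Rightarrow> ('k, 'w, 'p) module_scheme
      \<Rightarrow> ('k, 'v2, 'n2) module_scheme \<Rightarrow> ('k, 'w2, 'p2) module_scheme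
      \<Rightarrow> ('v \<Rightarrow> 'v2) \<Rightarrow> ('w \<Rightarrow> 'w2) \<Rightarrow> ('v \<times> 'w \<Rightarrow> 'k) set \<Rightarrow> ('v2 \<times> 'w2 \<Rightarrow> 'k) set"
  where "tensor_map K V W V' W' f g =
    tensor_lift K V W (tensor K V' W') (\<lambda>v w. pure_tensor K V' W' (f v) (g w))"

definition tensor_swap ::
    "('k, 'm) ring_scheme \<Rightarrow> ('k, 'v, 'n) module_scheme \<Rightarrow> ('k, 'w, 'p) module_scheme
      \<Rightarrow> ('v \<times> 'w \<Rightarrow> 'k) set \<Rightarrow> ('w \<times> 'v \<Rightarrow> 'k) set"
  where "tensor_swap K V W =
    tensor_lift K V W (tensor K W V) (\<lambda>v w. pure_tensor K W V w v)"

text \<open>The canonical identification of \<open>U \<otimes> (V \<otimes> W)\<close> with \<open>(U \<otimes> V) \<otimes> W\<close>.\<close>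

definition tensor_assoc ::
    "('k, 'm) ring_scheme \<Rightarrow> ('k, 'u, 'n) module_scheme \<Rightarrow> ('k, 'v, 'p) module_scheme
      \<Rightarrow> ('k, 'w, 'q) module_scheme
      \<Rightarrow> ('u \<times> ('v \<times> 'w \<Rightarrow> 'k) set \<Rightarrow> 'k) set \<Rightarrow> (('u \<times> 'v \<Rightarrow> 'k) set \<times> 'w \<Rightarrow> 'k) set"
  where "tensor_assoc K U V W =
    tensor_lift K U (tensor K V W) (tensor K (tensor K U V) W)
      (\<lambda>u. tensor_lift K V W (tensor K (tensor K U V) W)
        (\<lambda>v w. pure_tensor K (tensor K U V) W (pure_tensor K U V u v) w))"

lemma linear_comp:
  assumes "linear_map K U V f" "linear_map K V W g"
  shows "linear_map K U W (\<lambda>u. g (f u))"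
  by (rule linear_mapI[OF linear_map.axioms(1)[OF assms(1)] linear_map.axioms(2)[OF assms(2)]])
     (simp_all add: linear_mapD[OF assms(1)] linear_mapD[OF assms(2)])

lemma linear_pure_tensor:
  assumes "vectorspace K V" "vectorspace K W"
  shows "v \<in> carrier V \<Longrightarrow> linear_map K W (tensor K V W) (pure_tensor K V W v)"
    and "w \<in> carrier W \<Longrightarrow> linear_map K V (tensor K V W) (\<lambda>v. pure_tensor K V W v w)"
  using bilinear_pure_tensor[OF assms] unfolding bilinear_map_def by blast+

lemma pure_tensor_closed:
  assumes "vectorspace K V" "vectorspace K W" "v \<in> carrier V" "w \<in> carrier W"
  shows "pure_tensor K V W v w \<in> carrier (tensor K V W)"
  by (rule linear_mapD(1)[OF linear_pure_tensor(1)]) (use assms in auto)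

lemma
  assumes f: "linear_map K V V' f" and g: "linear_map K W W' g"
  shows linear_tensor_map:
      "linear_map K (tensor K V W) (tensor K V' W') (tensor_map K V W V' W' f g)"
    and tensor_map_pure: "\<lbrakk>v \<in> carrier V; w \<in> carrier W\<rbrakk> \<Longrightarrow>
      tensor_map K V W V' W' f g (pure_tensor K V W v w) = pure_tensor K V' W' (f v) (g w)"
proof -
  note vs = linear_map.axioms(1,2)[OF f] linear_map.axioms(1,2)[OF g]
  have B: "bilinear_map K V W (tensor K V' W') (\<lambda>v w. pure_tensor K V' W' (f v) (g w))"
    unfolding bilinear_map_def
    using linear_comp[OF g linear_pure_tensor(1)[OF vs(2,4)]]
      linear_comp[OF f linear_pure_tensor(2)[OF vs(2,4)]]
      linear_mapD(1)[OF f] linear_mapD(1)[OF g] by blast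
  show "linear_map K (tensor K V W) (tensor K V' W') (tensor_map K V W V' W' f g)"
    unfolding tensor_map_def
    by (rule linear_tensor_lift[OF vs(1,3) vectorspace_tensor[OF vs(2,4)] B])
  show "tensor_map K V W V' W' f g (pure_tensor K V W v w) = pure_tensor K V' W' (f v) (g w)"
    if "v \<in> carrier V" "w \<in> carrier W"
    unfolding tensor_map_def
    by (rule tensor_lift_pure[OF vs(1,3) vectorspace_tensor[OF vs(2,4)] B that])
qed

lemma
  assumes vs: "vectorspace K V" "vectorspace K W"
  shows linear_tensor_swap: "linear_map K (tensor K V W) (tensor K W V) (tensor_swap K V W)"
    and tensor_swap_pure: "\<lbrakk>v \<in> carrier V; w \<in> carrier W\<rbrakk> \<Longrightarrow>
      tensor_swap K V W (pure_tensor K V W v w) = pure_tensor K W V w v"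
proof -
  have B: "bilinear_map K V W (tensor K W V) (\<lambda>v w. pure_tensor K W V w v)"
    unfolding bilinear_map_def using linear_pure_tensor[OF vs(2,1)] by blast
  note lift = vs vectorspace_tensor[OF vs(2,1)] B
  show "linear_map K (tensor K V W) (tensor K W V) (tensor_swap K V W)"
    unfolding tensor_swap_def by (rule linear_tensor_lift[OF lift])
  show "tensor_swap K V W (pure_tensor K V W v w) = pure_tensor K W V w v"
    if "v \<in> carrier V" "w \<in> carrier W"
    unfolding tensor_swap_def by (rule tensor_lift_pure[OF lift that])
qed

lemma tensor_map_eqI:
  assumes "vectorspace K V" "vectorspace K W"
    and f: "linear_map K (tensor K V W) X f" and g: "linear_map K (tensor K V W) X g"
    and "\<And>v w. \<lbrakk>v \<in> carrier V; w \<in> carrier W\<rbrakk> \<Longrightarrow>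
      f (pure_tensor K V W v w) = g (pure_tensor K V W v w)"
    and "t \<in> carrier (tensor K V W)"
  shows "f t = g t"
  using assms(1,2,6)
proof (induction rule: tensor_induct)
  case zero
  then show ?case using linear_mapD(4)[OF f] linear_mapD(4)[OF g] by simp
next
  case (add v w t)
  then show ?case
    using linear_mapD(2)[OF f pure_tensor_closed[OF assms(1,2), of v w], of t]
      linear_mapD(2)[OF g pure_tensor_closed[OF assms(1,2), of v w], of t] assms(5)[of v w] by simp
qed

lemma linear_add:
  assumes "linear_map K V W f" "linear_map K V W g"
  shows "linear_map K V W (\<lambda>v. f v \<oplus>\<^bsub>W\<^esub> g v)"
proof -
  note vs = linear_map.axioms(1,2)[OF assms(1)]
  interpret W: vectorspace K W by (rule vs(2))
  show ?thesis
    by (rule linear_mapI[OF vs])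
       (simp_all add: linear_mapD[OF assms(1)] linear_mapD[OF assms(2)] W.M.add.m_ac
          W.smult_r_distr)
qed

lemma linear_smult:
  assumes "linear_map K V W f" "a \<in> carrier K"
  shows "linear_map K V W (\<lambda>v. a \<odot>\<^bsub>W\<^esub> f v)"
proof -
  note vs = linear_map.axioms(1,2)[OF assms(1)]
  interpret W: vectorspace K W by (rule vs(2))
  have comm: "a \<otimes>\<^bsub>K\<^esub> b = b \<otimes>\<^bsub>K\<^esub> a" if "b \<in> carrier K" for b
    using W.m_comm assms(2) that by simp
  show ?thesis
    by (rule linear_mapI[OF vs])
       (simp_all add: linear_mapD[OF assms(1)] W.smult_r_distr assms(2) comm
          flip: W.smult_assoc1)
qed

lemma
  assumes U: "vectorspace K U" and V: "vectorspace K V" and W: "vectorspace K W"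
  shows linear_tensor_assoc: "linear_map K (tensor K U (tensor K V W))
      (tensor K (tensor K U V) W) (tensor_assoc K U V W)"
    and tensor_assoc_pure: "\<lbrakk>u \<in> carrier U; v \<in> carrier V; w \<in> carrier W\<rbrakk> \<Longrightarrow>
      tensor_assoc K U V W (pure_tensor K U (tensor K V W) u (pure_tensor K V W v w)) =
      pure_tensor K (tensor K U V) W (pure_tensor K U V u v) w"
proof -
  let ?X = "tensor K (tensor K U V) W"
  let ?B = "\<lambda>u v w. pure_tensor K (tensor K U V) W (pure_tensor K U V u v) w"
  let ?L = "\<lambda>u. tensor_lift K V W ?X (?B u)"
  note UV = vectorspace_tensor[OF U V]
  note VW = vectorspace_tensor[OF V W]
  note X = vectorspace_tensor[OF UV W]
  have B: "bilinear_map K V W ?X (?B u)" if u: "u \<in> carrier U" for u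
    unfolding bilinear_map_def
    using linear_pure_tensor(1)[OF UV W] pure_tensor_closed[OF U V u]
      linear_comp[OF linear_pure_tensor(1)[OF U V u] linear_pure_tensor(2)[OF UV W]] by blast
  note L = linear_tensor_lift[OF V W X B] tensor_lift_pure[OF V W X B]
  have U1: "linear_map K U ?X (\<lambda>u. ?B u v w)" if "v \<in> carrier V" "w \<in> carrier W" for v w
    by (rule linear_comp[OF linear_pure_tensor(2)[OF U V that(1)] linear_pure_tensor(2)[OF UV W that(2)]])
  have "linear_map K U ?X (\<lambda>u. ?L u t)" if t: "t \<in> carrier (tensor K V W)" for t
  proof (rule linear_mapI[OF U X])
    show "?L u t \<in> carrier ?X" if "u \<in> carrier U" for u
      by (rule linear_mapD(1)[OF L(1)[OF that] t])
  next
    fix u u' assume u: "u \<in> carrier U" "u' \<in> carrier U"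
    have uu: "u \<oplus>\<^bsub>U\<^esub> u' \<in> carrier U"
    proof -
      interpret U: vectorspace K U by fact
      show ?thesis using u by simp
    qed
    show "?L (u \<oplus>\<^bsub>U\<^esub> u') t = ?L u t \<oplus>\<^bsub>?X\<^esub> ?L u' t"
      by (rule tensor_map_eqI[OF V W L(1)[OF uu] linear_add[OF L(1)[OF u(1)] L(1)[OF u(2)]] _ t])
         (simp add: L(2) u uu linear_mapD(2)[OF U1])
  next
    fix a u assume a: "a \<in> carrier K" and u: "u \<in> carrier U"
    have au: "a \<odot>\<^bsub>U\<^esub> u \<in> carrier U"
    proof -
      interpret U: vectorspace K U by fact
      show ?thesis using a u by simp
    qed
    show "?L (a \<odot>\<^bsub>U\<^esub> u) t = a \<odot>\<^bsub>?X\<^esub> ?L u t"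
      by (rule tensor_map_eqI[OF V W L(1)[OF au] linear_smult[OF L(1)[OF u] a] _ t])
         (simp add: L(2) u a au linear_mapD(3)[OF U1])
  qed
  then have BL: "bilinear_map K U (tensor K V W) ?X ?L"
    unfolding bilinear_map_def using L(1) by blast
  show "linear_map K (tensor K U (tensor K V W)) ?X (tensor_assoc K U V W)"
    unfolding tensor_assoc_def by (rule linear_tensor_lift[OF U VW X BL])
  show "tensor_assoc K U V W (pure_tensor K U (tensor K V W) u (pure_tensor K V W v w)) =
      pure_tensor K (tensor K U V) W (pure_tensor K U V u v) w"
    if "u \<in> carrier U" "v \<in> carrier V" "w \<in> carrier W"
    unfolding tensor_assoc_def
    using tensor_lift_pure[OF U VW X BL that(1) pure_tensor_closed[OF V W that(2,3)]] L(2) that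
    by simp
qed


section \<open>Hom-coalgebras\<close>

definition char_zero :: "('k, 'm) ring_scheme \<Rightarrow> bool"
  where "char_zero K \<longleftrightarrow> (\<forall>n::nat. n > 0 \<longrightarrow> [n] \<cdot>\<^bsub>K\<^esub> \<one>\<^bsub>K\<^esub> \<noteq> \<zero>\<^bsub>K\<^esub>)"

locale hom_comultiplication =
  fixes K :: "('k, 'm) ring_scheme" and C :: "('k, 'c, 'n) module_scheme"
    and \<Delta> :: "'c \<Rightarrow> ('c \<times> 'c \<Rightarrow> 'k) set" and \<alpha> :: "'c \<Rightarrow> 'c"
  assumes vectorspace: "vectorspace K C"
    and linear_comult: "linear_map K C (tensor K C C) \<Delta>"
    and linear_twist: "linear_map K C C \<alpha>"
begin

text \<open>\<open>(\<Delta> \<otimes> \<alpha>) \<circ> \<Delta>\<close> and \<open>(\<alpha> \<otimes> \<Delta>) \<circ> \<Delta>\<close>, both as maps into \<open>(C \<otimes> C) \<otimes> C\<close>.\<close>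

definition left_iterate :: "'c \<Rightarrow> (('c \<times> 'c \<Rightarrow> 'k) set \<times> 'c \<Rightarrow> 'k) set"
  where "left_iterate c = tensor_map K C C (tensor K C C) C \<Delta> \<alpha> (\<Delta> c)"

definition right_iterate :: "'c \<Rightarrow> (('c \<times> 'c \<Rightarrow> 'k) set \<times> 'c \<Rightarrow> 'k) set"
  where "right_iterate c =
    tensor_assoc K C C C (tensor_map K C C C (tensor K C C) \<alpha> \<Delta> (\<Delta> c))"

end

locale hom_coassociative_coalgebra = hom_comultiplication +
  assumes hom_coassociative: "c \<in> carrier C \<Longrightarrow> right_iterate c = left_iterate c"

locale hom_coassociative_rota_baxter_coalgebra = hom_coassociative_coalgebra K C \<Delta> \<alpha>
    for K :: "('k, 'm) ring_scheme" and C :: "('k, 'c, 'n) module_scheme" and \<Delta> \<alpha> +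
  fixes R :: "'c \<Rightarrow> 'c" and wt :: 'k
  assumes weight_closed: "wt \<in> carrier K"
    and linear_rota_baxter: "linear_map K C C R"
    and commute_twist: "c \<in> carrier C \<Longrightarrow> R (\<alpha> c) = \<alpha> (R c)"
    and rota_baxter: "c \<in> carrier C \<Longrightarrow>
      tensor_map K C C C C R R (\<Delta> c) =
        tensor_map K C C C C R (\<lambda>x. x) (\<Delta> (R c)) \<oplus>\<^bsub>tensor K C C\<^esub>
        tensor_map K C C C C (\<lambda>x. x) R (\<Delta> (R c)) \<oplus>\<^bsub>tensor K C C\<^esub>
        wt \<odot>\<^bsub>tensor K C C\<^esub> \<Delta> (R c)"

locale hom_preLie_coalgebra = hom_comultiplication +
  assumes hom_preLie: "c \<in> carrier C \<Longrightarrow>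
    left_iterate c \<ominus>\<^bsub>tensor K (tensor K C C) C\<^esub> right_iterate c =
      tensor_map K (tensor K C C) C (tensor K C C) C (tensor_swap K C C) (\<lambda>x. x)
        (left_iterate c \<ominus>\<^bsub>tensor K (tensor K C C) C\<^esub> right_iterate c)"

end

theory Submission
  imports Defs
begin

text \<open>
  With \<open>\<delta> = \<Delta>\<^sub>0 - \<tau> \<circ> \<Delta>\<^sub>0\<close> one has \<open>\<Delta> = (R \<otimes> I) \<circ> \<delta>\<close>. The cobracket \<open>\<delta>\<close> satisfies the Hom-Leibniz
  identity \<open>(\<delta> \<otimes> \<alpha>) \<circ> \<delta> = (1 - \<tau> \<otimes> I) \<circ> (\<alpha> \<otimes> \<delta>) \<circ> \<delta>\<close>, and in weight \<open>0\<close>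
  \<open>(R \<otimes> R) \<circ> \<delta> = (R \<otimes> I + I \<otimes> R) \<circ> \<delta> \<circ> R\<close>. Since \<open>\<tau> \<circ> \<delta> = - \<delta>\<close>, applying \<open>1 - \<tau> \<otimes> I\<close> to
  \<open>(\<Delta> \<otimes> \<alpha>) \<circ> \<Delta>\<close> and to \<open>(\<alpha> \<otimes> \<Delta>) \<circ> \<Delta>\<close> produces \<open>((R \<otimes> R) \<otimes> I)\<close> applied to the two sides of the
  Hom-Leibniz identity.
\<close>

section \<open>Calculus of linear maps on tensor products\<close>

lemma linear_id: "vectorspace K V \<Longrightarrow> linear_map K V V (\<lambda>v. v)"
  by (rule linear_mapI) auto

lemma linear_map_minus:
  assumes "linear_map K V W f" "v \<in> carrier V" "v' \<in> carrier V"
  shows "f (v \<ominus>\<^bsub>V\<^esub> v') = f v \<ominus>\<^bsub>W\<^esub> f v'"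
proof -
  interpret V: vectorspace K V by (rule linear_map.axioms(1)[OF assms(1)])
  interpret W: vectorspace K W by (rule linear_map.axioms(2)[OF assms(1)])
  have "f (\<ominus>\<^bsub>V\<^esub> v') \<oplus>\<^bsub>W\<^esub> f v' = \<zero>\<^bsub>W\<^esub>"
    using linear_mapD(2,4)[OF assms(1)] assms(3) by (metis V.M.add.inv_closed V.M.l_neg)
  then have "f (\<ominus>\<^bsub>V\<^esub> v') = \<ominus>\<^bsub>W\<^esub> f v'"
    using W.M.minus_equality linear_mapD(1)[OF assms(1)] assms(3) by (metis V.M.add.inv_closed)
  then show ?thesis
    using linear_mapD(2)[OF assms(1)] assms(2,3) by (simp add: a_minus_def)
qed

lemma linear_minus:
  assumes "linear_map K V W f" "linear_map K V W g"
  shows "linear_map K V W (\<lambda>v. f v \<ominus>\<^bsub>W\<^esub> g v)"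
proof -
  note vs = linear_map.axioms(1,2)[OF assms(1)]
  interpret W: vectorspace K W by (rule vs(2))
  show ?thesis
    by (rule linear_mapI[OF vs])
       (simp_all add: linear_mapD[OF assms(1)] linear_mapD[OF assms(2)] a_minus_def
          W.M.minus_add W.M.a_ac W.smult_r_distr W.smult_r_minus)
qed

section \<open>Functoriality and additivity of tensor products of maps\<close>

lemma tensor_map_closed:
  assumes "linear_map K V V' f" "linear_map K W W' g" "t \<in> carrier (tensor K V W)"
  shows "tensor_map K V W V' W' f g t \<in> carrier (tensor K V' W')"
  using linear_mapD(1)[OF linear_tensor_map[OF assms(1,2)] assms(3)] .

text \<open>Maps are total HOL functions, so two of them may agree on a carrier without being equal.
  Comparing the induced maps on pure tensors lets identities valid only on carriers be used inside a
  tensor factor.\<close>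

lemma tensor_map_cong:
  assumes "\<And>v. v \<in> carrier V \<Longrightarrow> f v = f' v" "\<And>w. w \<in> carrier W \<Longrightarrow> g w = g' w"
    and "linear_map K V V' f" "linear_map K W W' g"
    and "linear_map K V V' f'" "linear_map K W W' g'"
    and "t \<in> carrier (tensor K V W)"
  shows "tensor_map K V W V' W' f g t = tensor_map K V W V' W' f' g' t"
  by (rule tensor_map_eqI[OF linear_map.axioms(1)[OF assms(3)] linear_map.axioms(1)[OF assms(4)]
        linear_tensor_map[OF assms(3,4)] linear_tensor_map[OF assms(5,6)] _ assms(7)])
     (simp add: tensor_map_pure[OF assms(3,4)] tensor_map_pure[OF assms(5,6)] assms(1,2))

lemma tensor_map_comp:
  assumes f: "linear_map K V V' f" and g: "linear_map K W W' g"
    and f': "linear_map K V' V'' f'" and g': "linear_map K W' W'' g'"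
    and "t \<in> carrier (tensor K V W)"
  shows "tensor_map K V' W' V'' W'' f' g' (tensor_map K V W V' W' f g t) =
    tensor_map K V W V'' W'' (\<lambda>v. f' (f v)) (\<lambda>w. g' (g w)) t"
  by (rule tensor_map_eqI[OF linear_map.axioms(1)[OF f] linear_map.axioms(1)[OF g]
        linear_comp[OF linear_tensor_map[OF f g] linear_tensor_map[OF f' g']]
        linear_tensor_map[OF linear_comp[OF f f'] linear_comp[OF g g']] _ assms(5)])
     (simp add: tensor_map_pure[OF f g] tensor_map_pure[OF f' g'] linear_mapD(1)[OF f]
        linear_mapD(1)[OF g] tensor_map_pure[OF linear_comp[OF f f'] linear_comp[OF g g']])

lemma tensor_map_minus_left:
  assumes f: "linear_map K V V' f" and f': "linear_map K V V' f'" and g: "linear_map K W W' g"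
    and "t \<in> carrier (tensor K V W)"
  shows "tensor_map K V W V' W' (\<lambda>v. f v \<ominus>\<^bsub>V'\<^esub> f' v) g t =
    tensor_map K V W V' W' f g t \<ominus>\<^bsub>tensor K V' W'\<^esub> tensor_map K V W V' W' f' g t"
proof -
  note vs = linear_map.axioms(2)[OF f] linear_map.axioms(2)[OF g]
  show ?thesis
    by (rule tensor_map_eqI[OF linear_map.axioms(1)[OF f] linear_map.axioms(1)[OF g]
          linear_tensor_map[OF linear_minus[OF f f'] g]
          linear_minus[OF linear_tensor_map[OF f g] linear_tensor_map[OF f' g]] _ assms(4)])
       (simp add: tensor_map_pure[OF f g] tensor_map_pure[OF f' g]
          tensor_map_pure[OF linear_minus[OF f f'] g] linear_mapD(1)[OF f] linear_mapD(1)[OF f']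
          linear_mapD(1)[OF g] linear_map_minus[OF linear_pure_tensor(2)[OF vs]])
qed

lemma tensor_map_minus_right:
  assumes f: "linear_map K V V' f" and g: "linear_map K W W' g" and g': "linear_map K W W' g'"
    and "t \<in> carrier (tensor K V W)"
  shows "tensor_map K V W V' W' f (\<lambda>w. g w \<ominus>\<^bsub>W'\<^esub> g' w) t =
    tensor_map K V W V' W' f g t \<ominus>\<^bsub>tensor K V' W'\<^esub> tensor_map K V W V' W' f g' t"
proof -
  note vs = linear_map.axioms(2)[OF f] linear_map.axioms(2)[OF g]
  show ?thesis
    by (rule tensor_map_eqI[OF linear_map.axioms(1)[OF f] linear_map.axioms(1)[OF g]
          linear_tensor_map[OF f linear_minus[OF g g']]
          linear_minus[OF linear_tensor_map[OF f g] linear_tensor_map[OF f g']] _ assms(4)])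
       (simp add: tensor_map_pure[OF f g] tensor_map_pure[OF f g']
          tensor_map_pure[OF f linear_minus[OF g g']] linear_mapD(1)[OF f] linear_mapD(1)[OF g']
          linear_mapD(1)[OF g] linear_map_minus[OF linear_pure_tensor(1)[OF vs]])
qed

section \<open>The swap, and maps on threefold tensor products\<close>

lemma tensor_swap_closed:
  assumes "vectorspace K V" "vectorspace K W" "t \<in> carrier (tensor K V W)"
  shows "tensor_swap K V W t \<in> carrier (tensor K W V)"
  using linear_mapD(1)[OF linear_tensor_swap[OF assms(1,2)] assms(3)] .

lemma tensor_swap_swap:
  assumes "vectorspace K V" "vectorspace K W" "t \<in> carrier (tensor K V W)"
  shows "tensor_swap K W V (tensor_swap K V W t) = t"
  by (rule tensor_map_eqI[OF assms(1,2) linear_comp[OF linear_tensor_swap linear_tensor_swap]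
        linear_id[OF vectorspace_tensor] _ assms(3)])
     (simp_all add: assms tensor_swap_pure)

lemma tensor_swap_map:
  assumes f: "linear_map K V V' f" and g: "linear_map K W W' g"
    and "t \<in> carrier (tensor K V W)"
  shows "tensor_swap K V' W' (tensor_map K V W V' W' f g t) =
    tensor_map K W V W' V' g f (tensor_swap K V W t)"
proof -
  note vs = linear_map.axioms(1,2)[OF f] linear_map.axioms(1,2)[OF g]
  show ?thesis
    by (rule tensor_map_eqI[OF vs(1,3)
          linear_comp[OF linear_tensor_map[OF f g] linear_tensor_swap[OF vs(2,4)]]
          linear_comp[OF linear_tensor_swap[OF vs(1,3)] linear_tensor_map[OF g f]] _ assms(3)])
       (simp add: tensor_map_pure[OF f g] tensor_map_pure[OF g f] tensor_swap_pure vs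
          linear_mapD(1)[OF f] linear_mapD(1)[OF g])
qed

text \<open>For fixed \<open>w\<close> both sides are linear in the inner tensor \<open>s\<close>,
  so the comparison on pure tensors is applied twice: first in \<open>s\<close>, then on the outer
  product.\<close>

lemma tensor_map_eqI_left:
  assumes U: "vectorspace K U" and V: "vectorspace K V" and W: "vectorspace K W"
    and f: "linear_map K (tensor K (tensor K U V) W) X f"
    and g: "linear_map K (tensor K (tensor K U V) W) X g"
    and eq: "\<And>u v w. \<lbrakk>u \<in> carrier U; v \<in> carrier V; w \<in> carrier W\<rbrakk> \<Longrightarrow>
      f (pure_tensor K (tensor K U V) W (pure_tensor K U V u v) w) =
      g (pure_tensor K (tensor K U V) W (pure_tensor K U V u v) w)"
    and t: "t \<in> carrier (tensor K (tensor K U V) W)"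
  shows "f t = g t"
proof -
  note UV = vectorspace_tensor[OF U V]
  have "f (pure_tensor K (tensor K U V) W s w) = g (pure_tensor K (tensor K U V) W s w)"
    if "s \<in> carrier (tensor K U V)" "w \<in> carrier W" for s w
    by (rule tensor_map_eqI[OF U V linear_comp[OF linear_pure_tensor(2)[OF UV W that(2)] f]
          linear_comp[OF linear_pure_tensor(2)[OF UV W that(2)] g] _ that(1)])
       (use eq that(2) in blast)
  then show ?thesis by (rule tensor_map_eqI[OF UV W f g _ t])
qed

lemma tensor_map_eqI_right:
  assumes U: "vectorspace K U" and V: "vectorspace K V" and W: "vectorspace K W"
    and f: "linear_map K (tensor K U (tensor K V W)) X f"
    and g: "linear_map K (tensor K U (tensor K V W)) X g"
    and eq: "\<And>u v w. \<lbrakk>u \<in> carrier U; v \<in> carrier V; w \<in> carrier W\<rbrakk> \<Longrightarrow>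
      f (pure_tensor K U (tensor K V W) u (pure_tensor K V W v w)) =
      g (pure_tensor K U (tensor K V W) u (pure_tensor K V W v w))"
    and t: "t \<in> carrier (tensor K U (tensor K V W))"
  shows "f t = g t"
proof -
  note VW = vectorspace_tensor[OF V W]
  have "f (pure_tensor K U (tensor K V W) u s) = g (pure_tensor K U (tensor K V W) u s)"
    if "u \<in> carrier U" "s \<in> carrier (tensor K V W)" for s u
    by (rule tensor_map_eqI[OF V W linear_comp[OF linear_pure_tensor(1)[OF U VW that(1)] f]
          linear_comp[OF linear_pure_tensor(1)[OF U VW that(1)] g] _ that(2)])
       (use eq that(1) in blast)
  then show ?thesis by (rule tensor_map_eqI[OF U VW f g _ t])
qed

text \<open>Naturality of the associativity isomorphism, checked on pure triple tensors. It will
  turn R \<otimes> (R \<otimes> I) into (R \<otimes> R) \<otimes> I.\<close>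

lemma tensor_assoc_map:
  assumes f: "linear_map K U U' f" and g: "linear_map K V V' g" and h: "linear_map K W W' h"
    and t: "t \<in> carrier (tensor K U (tensor K V W))"
  shows "tensor_assoc K U' V' W'
      (tensor_map K U (tensor K V W) U' (tensor K V' W') f (tensor_map K V W V' W' g h) t) =
    tensor_map K (tensor K U V) W (tensor K U' V') W' (tensor_map K U V U' V' f g) h
      (tensor_assoc K U V W t)"
proof -
  note vs = linear_map.axioms(1,2)[OF f] linear_map.axioms(1,2)[OF g] linear_map.axioms(1,2)[OF h]
  note gh = linear_tensor_map[OF g h]
  note fg = linear_tensor_map[OF f g]
  show ?thesis
    by (rule tensor_map_eqI_right[OF vs(1,3,5)
          linear_comp[OF linear_tensor_map[OF f gh] linear_tensor_assoc[OF vs(2,4,6)]]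
          linear_comp[OF linear_tensor_assoc[OF vs(1,3,5)] linear_tensor_map[OF fg h]] _ t])
       (simp add: tensor_map_pure[OF f gh] tensor_map_pure[OF g h] tensor_map_pure[OF f g]
          tensor_map_pure[OF fg h] tensor_assoc_pure vs pure_tensor_closed
          linear_mapD(1)[OF f] linear_mapD(1)[OF g] linear_mapD(1)[OF h])
qed

section \<open>The cobracket\<close>

text \<open>The Hom-preLie identity asks that L - R be fixed by \<open>flip\<close>, where L and R
  are the two iterates, while the computation yields L - flip L = R - flip R. This rearrangement
  passes from the latter to the former.\<close>

lemma (in abelian_group) minus_eq_minus_swap:
  assumes "x \<in> carrier G" "x' \<in> carrier G" "y \<in> carrier G" "y' \<in> carrier G"
    and "x \<ominus> x' = y \<ominus> y'"
  shows "x \<ominus> y = x' \<ominus> y'"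
proof -
  have "x \<ominus> y = (x \<ominus> x') \<oplus> x' \<ominus> y"
    using assms(1-4) by (simp add: a_minus_def a_assoc l_neg)
  also have "\<dots> = x' \<ominus> y'"
    unfolding assms(5) using assms(1-4) by (simp add: a_minus_def a_ac r_neg r_neg1 r_neg2)
  finally show ?thesis .
qed

context hom_comultiplication
begin

abbreviation CC where "CC \<equiv> tensor K C C"
abbreviation CCC where "CCC \<equiv> tensor K CC C"
abbreviation flip where "flip \<equiv> tensor_map K CC C CC C (tensor_swap K C C) (\<lambda>x. x)"

text \<open>
  \<open>rotate\<close> sends \<open>(u \<otimes> v) \<otimes> w\<close> to \<open>(w \<otimes> u) \<otimes> v\<close>. Together with \<open>flip\<close> it generates the action of
  \<open>S\<^sub>3\<close> on \<open>C \<otimes> C \<otimes> C\<close>, in whose group algebra the Hom-Leibniz identity for \<open>\<delta>\<close> is checked.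
\<close>

definition rotate where "rotate t = tensor_assoc K C C C (tensor_swap K CC C t)"
text \<open>Dual to the commutator of an associative product.\<close>

definition cobracket where "cobracket c = \<Delta> c \<ominus>\<^bsub>CC\<^esub> tensor_swap K C C (\<Delta> c)"

lemma vectorspace_CC: "vectorspace K CC" by (rule vectorspace_tensor[OF vectorspace vectorspace])
lemma vectorspace_CCC: "vectorspace K CCC" by (rule vectorspace_tensor[OF vectorspace_CC vectorspace])

lemma linear_swap: "linear_map K CC CC (tensor_swap K C C)"
  by (rule linear_tensor_swap[OF vectorspace vectorspace])

lemma linear_flip: "linear_map K CCC CCC flip"
  by (rule linear_tensor_map[OF linear_swap linear_id[OF vectorspace]])

lemma linear_assoc: "linear_map K (tensor K C CC) CCC (tensor_assoc K C C C)"
  by (rule linear_tensor_assoc[OF vectorspace vectorspace vectorspace])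

lemma linear_rotate: "linear_map K CCC CCC rotate"
  unfolding rotate_def
  by (rule linear_comp[OF linear_tensor_swap[OF vectorspace_CC vectorspace] linear_assoc])

lemma linear_cobracket: "linear_map K C CC cobracket"
  unfolding cobracket_def
  by (rule linear_minus[OF linear_comult linear_comp[OF linear_comult linear_swap]])

text \<open>These rules evaluate swaps, flips, rotations and reassociations on pure tensors, so that
  relations between permutations are settled by simplification.\<close>

lemmas pure_simps = tensor_swap_pure tensor_assoc_pure pure_tensor_closed vectorspace
  vectorspace_CC vectorspace_CCC tensor_map_pure[OF linear_swap linear_id[OF vectorspace]]
  tensor_map_pure[OF linear_id[OF vectorspace] linear_swap] rotate_def

section \<open>Relations in the S_3 action on threefold tensors\<close>

lemma flip_flip:
  assumes "t \<in> carrier CCC" shows "flip (flip t) = t"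
  by (rule tensor_map_eqI_left[OF vectorspace vectorspace vectorspace
        linear_comp[OF linear_flip linear_flip] linear_id[OF vectorspace_CCC] _ assms])
     (simp add: pure_simps)

text \<open>Both sides send u \<otimes> (v \<otimes> w) to (v \<otimes> w) \<otimes> u.\<close>

lemma swap_eq_rotate:
  assumes "t \<in> carrier (tensor K C CC)"
  shows "tensor_swap K C CC t = rotate (rotate (tensor_assoc K C C C t))"
  by (rule tensor_map_eqI_right[OF vectorspace vectorspace vectorspace
        linear_tensor_swap[OF vectorspace vectorspace_CC]
        linear_comp[OF linear_comp[OF linear_assoc linear_rotate] linear_rotate] _ assms])
     (simp add: pure_simps)

text \<open>Exchanging the last two factors is a 3-cycle followed by the transposition of the first
  two: both sides send u \<otimes> (v \<otimes> w) to (u \<otimes> w) \<otimes> v.\<close>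

lemma assoc_swap:
  assumes "t \<in> carrier (tensor K C CC)"
  shows "tensor_assoc K C C C (tensor_map K C CC C CC (\<lambda>x. x) (tensor_swap K C C) t) =
    flip (rotate (tensor_assoc K C C C t))"
  by (rule tensor_map_eqI_right[OF vectorspace vectorspace vectorspace
        linear_comp[OF linear_tensor_map[OF linear_id[OF vectorspace] linear_swap] linear_assoc]
        linear_comp[OF linear_comp[OF linear_assoc linear_rotate] linear_flip] _ assms])
     (simp add: pure_simps)

end

text \<open>Hom-coassociativity turns every term into an S_3-image of the single element
  \<open>A\<close>. With P = A - rotate A and Q = rotate A - rotate (rotate A), both sides become P
  + Q - flip P - flip Q.\<close>

lemma (in hom_coassociative_coalgebra) cobracket_leibniz:
  assumes c: "c \<in> carrier C"
  defines "x \<equiv> tensor_assoc K C C C (tensor_map K C C C CC \<alpha> cobracket (cobracket c))"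
  shows "tensor_map K C C CC C cobracket \<alpha> (cobracket c) = x \<ominus>\<^bsub>CCC\<^esub> flip x"
proof -
  interpret CCC: vectorspace K CCC by (rule vectorspace_CCC)
  note id = linear_id[OF vectorspace]
  note swap_comult = linear_comp[OF linear_comult linear_swap]
  note D = linear_mapD(1)[OF linear_comult c] and d = linear_mapD(1)[OF linear_cobracket c]
  note D' = linear_mapD(1)[OF linear_swap D]
  note l = linear_tensor_map[OF linear_comult linear_twist]
  note r = linear_tensor_map[OF linear_twist linear_comult]
  let ?a = "tensor_assoc K C C C"
  define A where "A = tensor_map K C C CC C \<Delta> \<alpha> (\<Delta> c)"
  define B where "B = tensor_map K C C C CC \<alpha> \<Delta> (\<Delta> c)"
  have A: "A \<in> carrier CCC" unfolding A_def by (rule linear_mapD(1)[OF l D])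
  have B: "B \<in> carrier (tensor K C CC)" unfolding B_def by (rule linear_mapD(1)[OF r D])
  have aB: "?a B = A"
    using hom_coassociative[OF c] by (simp add: right_iterate_def left_iterate_def A_def B_def)
  note rot = linear_mapD(1)[OF linear_rotate] and fl = linear_mapD(1)[OF linear_flip]
  have left: "tensor_map K C C CC C cobracket \<alpha> t =
      tensor_map K C C CC C \<Delta> \<alpha> t \<ominus>\<^bsub>CCC\<^esub> flip (tensor_map K C C CC C \<Delta> \<alpha> t)"
    if "t \<in> carrier CC" for t
    unfolding cobracket_def tensor_map_minus_left[OF linear_comult swap_comult linear_twist that]
      tensor_map_comp[OF linear_comult linear_twist linear_swap id that] ..
  have right: "?a (tensor_map K C C C CC \<alpha> cobracket t) =
      ?a (tensor_map K C C C CC \<alpha> \<Delta> t) \<ominus>\<^bsub>CCC\<^esub> flip (rotate (?a (tensor_map K C C C CC \<alpha> \<Delta> t)))"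
    if "t \<in> carrier CC" for t
    unfolding cobracket_def tensor_map_minus_right[OF linear_twist linear_comult swap_comult that]
      tensor_map_comp[OF linear_twist linear_comult id linear_swap that, symmetric]
      linear_map_minus[OF linear_assoc linear_mapD(1)[OF r that]
        tensor_map_closed[OF id linear_swap linear_mapD(1)[OF r that]]]
      assoc_swap[OF linear_mapD(1)[OF r that]] ..
  \<comment> \<open>Naturality rewrites (\<Delta> \<otimes> \<alpha>) \<circ> \<tau> as \<tau>
    \<circ> (\<alpha> \<otimes> \<Delta>), so the second term is the swap of \<open>B\<close>, that
    is, two rotations of \<open>A\<close>.\<close>
  have Z: "tensor_map K C C CC C \<Delta> \<alpha> (cobracket c) = A \<ominus>\<^bsub>CCC\<^esub> rotate (rotate A)"
    unfolding cobracket_def linear_map_minus[OF l D D']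
      tensor_swap_map[OF linear_twist linear_comult D, symmetric]
    by (simp flip: A_def B_def add: swap_eq_rotate[OF B] aB)
  \<comment> \<open>Here the second term is the reassociated swap of \<open>A\<close>, which is one
    rotation of \<open>A\<close>.\<close>
  have Y: "?a (tensor_map K C C C CC \<alpha> \<Delta> (cobracket c)) = A \<ominus>\<^bsub>CCC\<^esub> rotate A"
    unfolding cobracket_def linear_map_minus[OF r D D']
      tensor_swap_map[OF linear_comult linear_twist D, symmetric]
    by (simp flip: A_def B_def rotate_def add: aB
        linear_map_minus[OF linear_assoc B tensor_swap_closed[OF vectorspace_CC vectorspace A]])
  define P where "P = A \<ominus>\<^bsub>CCC\<^esub> rotate A"
  \<comment> \<open>\<open>Q\<close> is the rotation of \<open>P\<close>, so the correction term in
    \<open>right\<close> becomes \<open>flip Q\<close>; the sum of \<open>P\<close> and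
    \<open>Q\<close> telescopes to the value in \<open>Z\<close>.\<close>
  define Q where "Q = rotate A \<ominus>\<^bsub>CCC\<^esub> rotate (rotate A)"
  have P: "P \<in> carrier CCC" and Q: "Q \<in> carrier CCC"
    by (simp_all add: P_def Q_def A rot)
  have PQ: "A \<ominus>\<^bsub>CCC\<^esub> rotate (rotate A) = P \<oplus>\<^bsub>CCC\<^esub> Q"
    by (simp add: P_def Q_def A rot a_minus_def CCC.M.a_assoc CCC.M.r_neg1)
  have x: "x = P \<ominus>\<^bsub>CCC\<^esub> flip Q"
    unfolding x_def right[OF d] Y P_def Q_def
    by (simp add: linear_map_minus[OF linear_rotate] A rot)
  show ?thesis
    unfolding left[OF d] Z PQ x linear_mapD(2)[OF linear_flip P Q]
      linear_map_minus[OF linear_flip P fl[OF Q]] flip_flip[OF Q]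
    by (simp add: P Q fl a_minus_def CCC.M.minus_add CCC.M.a_ac)
qed

section \<open>Rota-Baxter operators of weight zero\<close>

context hom_coassociative_rota_baxter_coalgebra
begin

abbreviation R_left where "R_left \<equiv> tensor_map K C C C C R (\<lambda>x. x)"
abbreviation R_right where "R_right \<equiv> tensor_map K C C C C (\<lambda>x. x) R"
abbreviation R_both where "R_both \<equiv> tensor_map K C C C C R R"
abbreviation R_first_two where "R_first_two \<equiv> tensor_map K CC C CC C R_both (\<lambda>x. x)"

definition preLie_comult where
  "preLie_comult c = R_left (\<Delta> c) \<ominus>\<^bsub>CC\<^esub> tensor_swap K C C (R_right (\<Delta> c))"

lemma linear_R_left: "linear_map K CC CC R_left"
  by (rule linear_tensor_map[OF linear_rota_baxter linear_id[OF vectorspace]])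

lemma linear_R_right: "linear_map K CC CC R_right"
  by (rule linear_tensor_map[OF linear_id[OF vectorspace] linear_rota_baxter])

lemma linear_R_both: "linear_map K CC CC R_both"
  by (rule linear_tensor_map[OF linear_rota_baxter linear_rota_baxter])

lemma linear_R_first_two: "linear_map K CCC CCC R_first_two"
  by (rule linear_tensor_map[OF linear_R_both linear_id[OF vectorspace]])

lemma linear_preLie_comult: "linear_map K C CC preLie_comult"
  unfolding preLie_comult_def
  by (rule linear_minus[OF linear_comp[OF linear_comult linear_R_left]
        linear_comp[OF linear_comp[OF linear_comult linear_R_right] linear_swap]])

text \<open>Naturality of the swap gives (R \<otimes> I) \<circ> \<tau> = \<tau> \<circ> (I
  \<otimes> R) and its analogues.\<close>

lemma R_cobracket:
  assumes "c \<in> carrier C"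
  shows "R_left (cobracket c) = preLie_comult c"
    and "R_right (cobracket c) = R_right (\<Delta> c) \<ominus>\<^bsub>CC\<^esub> tensor_swap K C C (R_left (\<Delta> c))"
    and "R_both (cobracket c) = R_both (\<Delta> c) \<ominus>\<^bsub>CC\<^esub> tensor_swap K C C (R_both (\<Delta> c))"
proof -
  note id = linear_id[OF vectorspace]
  note D = linear_mapD(1)[OF linear_comult assms]
  note D' = linear_mapD(1)[OF linear_swap D]
  show "R_left (cobracket c) = preLie_comult c"
    unfolding cobracket_def preLie_comult_def linear_map_minus[OF linear_R_left D D']
      tensor_swap_map[OF id linear_rota_baxter D] ..
  show "R_right (cobracket c) = R_right (\<Delta> c) \<ominus>\<^bsub>CC\<^esub> tensor_swap K C C (R_left (\<Delta> c))"
    unfolding cobracket_def linear_map_minus[OF linear_R_right D D']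
      tensor_swap_map[OF linear_rota_baxter id D] ..
  show "R_both (cobracket c) = R_both (\<Delta> c) \<ominus>\<^bsub>CC\<^esub> tensor_swap K C C (R_both (\<Delta> c))"
    unfolding cobracket_def linear_map_minus[OF linear_R_both D D']
      tensor_swap_map[OF linear_rota_baxter linear_rota_baxter D] ..
qed

text \<open>The Rota-Baxter identity replaces (R \<otimes> R) applied to \<open>\<Delta> c\<close>
  by two terms in \<open>\<Delta> (R c)\<close>. Subtracting their swaps and using \<tau> \<circ>
  \<tau> = I, the four terms regroup.\<close>

lemma rota_baxter_cobracket:
  assumes wt: "wt = \<zero>\<^bsub>K\<^esub>" and c: "c \<in> carrier C"
  shows "R_both (cobracket c) =
    preLie_comult (R c) \<ominus>\<^bsub>CC\<^esub> tensor_swap K C C (preLie_comult (R c))"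
proof -
  interpret CC: vectorspace K CC by (rule vectorspace_CC)
  note Rc = linear_mapD(1)[OF linear_rota_baxter c]
  note D = linear_mapD(1)[OF linear_comult Rc]
  note PQ = linear_mapD(1)[OF linear_R_left D] linear_mapD(1)[OF linear_R_right D]
  note tPQ = PQ[THEN linear_mapD(1)[OF linear_swap]]
  \<comment> \<open>The weight term vanishes because \<open>wt\<close> is zero.\<close>
  have RB: "R_both (\<Delta> c) = R_left (\<Delta> (R c)) \<oplus>\<^bsub>CC\<^esub> R_right (\<Delta> (R c))"
    using rota_baxter[OF c] PQ D by (simp add: wt)
  show ?thesis
    unfolding R_cobracket(3)[OF c] RB preLie_comult_def linear_mapD(2)[OF linear_swap PQ]
      linear_map_minus[OF linear_swap PQ(1) tPQ(2)] tensor_swap_swap[OF vectorspace vectorspace PQ(2)]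
    using PQ tPQ by (simp add: a_minus_def CC.M.minus_add CC.M.a_ac)
qed

text \<open>R \<otimes> R has the same map in both factors, so it commutes with the swap.\<close>

lemma flip_R_first_two:
  assumes "t \<in> carrier CCC"
  shows "flip (R_first_two t) = R_first_two (flip t)"
proof -
  note id = linear_id[OF vectorspace]
  show ?thesis
    unfolding tensor_map_comp[OF linear_R_both id linear_swap id assms]
      tensor_map_comp[OF linear_swap id linear_R_both id assms]
    by (rule tensor_map_cong[OF tensor_swap_map[OF linear_rota_baxter linear_rota_baxter] _
          linear_comp[OF linear_R_both linear_swap] id linear_comp[OF linear_swap linear_R_both] id
          assms]) simp_all
qed

lemma hom_preLie_preLie_comult:
  assumes wt: "wt = \<zero>\<^bsub>K\<^esub>"
  shows "hom_preLie_coalgebra K C preLie_comult \<alpha>"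
proof -
  interpret P: hom_comultiplication K C preLie_comult \<alpha>
    by (rule hom_comultiplication.intro[OF vectorspace linear_preLie_comult linear_twist])
  interpret CCC: vectorspace K CCC by (rule vectorspace_CCC)
  note id = linear_id[OF vectorspace]
  note RP = linear_comp[OF linear_rota_baxter linear_preLie_comult]
  note RPs = linear_comp[OF RP linear_swap]
  show ?thesis
  proof (unfold_locales)
    fix c assume c: "c \<in> carrier C"
    note d = linear_mapD(1)[OF linear_cobracket c]
    let ?L = "P.left_iterate c" and ?R = "P.right_iterate c"
    let ?B = "tensor_map K C C C CC \<alpha> cobracket (cobracket c)"
    let ?x = "tensor_assoc K C C C ?B"
    have B: "?B \<in> carrier (tensor K C CC)"
      by (rule tensor_map_closed[OF linear_twist linear_cobracket d])
    have x: "?x \<in> carrier CCC" by (rule linear_mapD(1)[OF linear_assoc B])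
    have L: "?L = tensor_map K C C CC C (\<lambda>v. preLie_comult (R v)) \<alpha> (cobracket c)"
      unfolding P.left_iterate_def R_cobracket(1)[OF c, symmetric]
      by (rule tensor_map_comp[OF linear_rota_baxter id linear_preLie_comult linear_twist d])
    \<comment> \<open>Pulling \<open>flip\<close> into the first tensor factor prepares the
      weight-zero identity, which then replaces that factor by R \<otimes> R after the
      cobracket.\<close>
    have "?L \<ominus>\<^bsub>CCC\<^esub> flip ?L = tensor_map K C C CC C
        (\<lambda>v. preLie_comult (R v) \<ominus>\<^bsub>CC\<^esub> tensor_swap K C C (preLie_comult (R v))) \<alpha> (cobracket c)"
      unfolding L tensor_map_comp[OF RP linear_twist linear_swap id d]
        tensor_map_minus_left[OF RP RPs linear_twist d] ..
    also have "\<dots> = tensor_map K C C CC C (\<lambda>v. R_both (cobracket v)) \<alpha> (cobracket c)"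
      by (rule tensor_map_cong[OF rota_baxter_cobracket[OF wt, symmetric] _ linear_minus[OF RP RPs]
            linear_twist linear_comp[OF linear_cobracket linear_R_both] linear_twist d]) simp_all
    also have "\<dots> = R_first_two (tensor_map K C C CC C cobracket \<alpha> (cobracket c))"
      by (rule tensor_map_comp[OF linear_cobracket linear_twist linear_R_both id d, symmetric])
    also have "\<dots> = R_first_two ?x \<ominus>\<^bsub>CCC\<^esub> flip (R_first_two ?x)"
      unfolding cobracket_leibniz[OF c] flip_R_first_two[OF x]
      by (rule linear_map_minus[OF linear_R_first_two x linear_mapD(1)[OF linear_flip x]])
    \<comment> \<open>One R comes from commuting R past \<alpha>, the other from the R \<otimes> I
      in the new comultiplication; naturality of associativity gathers both on the first two
      factors.\<close>
    also have "R_first_two ?x = ?R"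
    proof -
      have "tensor_map K C C C CC \<alpha> preLie_comult (preLie_comult c) =
          tensor_map K C C C CC (\<lambda>v. \<alpha> (R v)) preLie_comult (cobracket c)"
        unfolding R_cobracket(1)[OF c, symmetric]
        by (rule tensor_map_comp[OF linear_rota_baxter id linear_twist linear_preLie_comult d])
      also have "\<dots> = tensor_map K C C C CC (\<lambda>v. R (\<alpha> v)) (\<lambda>v. R_left (cobracket v)) (cobracket c)"
        by (rule tensor_map_cong[OF commute_twist[symmetric] R_cobracket(1)[symmetric]
              linear_comp[OF linear_rota_baxter linear_twist] linear_preLie_comult
              linear_comp[OF linear_twist linear_rota_baxter]
              linear_comp[OF linear_cobracket linear_R_left] d])
      also have "\<dots> = tensor_map K C CC C CC R R_left ?B"
        by (rule tensor_map_comp[OF linear_twist linear_cobracket linear_rota_baxter linear_R_left d,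
              symmetric])
      finally show ?thesis
        unfolding P.right_iterate_def
        by (simp add: tensor_assoc_map[OF linear_rota_baxter linear_rota_baxter id B])
    qed
    finally have eq: "?L \<ominus>\<^bsub>CCC\<^esub> flip ?L = ?R \<ominus>\<^bsub>CCC\<^esub> flip ?R" .
    have L: "?L \<in> carrier CCC"
      unfolding L by (rule tensor_map_closed[OF RP linear_twist d])
    have R: "?R \<in> carrier CCC"
      unfolding P.right_iterate_def
      by (intro linear_mapD(1)[OF linear_assoc] tensor_map_closed[OF linear_twist linear_preLie_comult]
          linear_mapD(1)[OF linear_preLie_comult] c)
    note fl = linear_mapD(1)[OF linear_flip]
    show "?L \<ominus>\<^bsub>CCC\<^esub> ?R = flip (?L \<ominus>\<^bsub>CCC\<^esub> ?R)"
      unfolding linear_map_minus[OF linear_flip L R]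
      by (rule CCC.M.minus_eq_minus_swap[OF L fl[OF L] R fl[OF R] eq])
  qed
qed

end

theorem proposition3p14:
  fixes K :: "('k, 'm) ring_scheme" and C :: "('k, 'c, 'n) module_scheme"
    and \<Delta>\<^sub>0 :: "'c \<Rightarrow> ('c \<times> 'c \<Rightarrow> 'k) set" and \<alpha> R :: "'c \<Rightarrow> 'c"
  assumes "field K" and "char_zero K"
    and "hom_coassociative_rota_baxter_coalgebra K C \<Delta>\<^sub>0 \<alpha> R \<zero>\<^bsub>K\<^esub>"
  shows "hom_preLie_coalgebra K C
    (\<lambda>c. tensor_map K C C C C R (\<lambda>x. x) (\<Delta>\<^sub>0 c) \<ominus>\<^bsub>tensor K C C\<^esub>
         tensor_swap K C C (tensor_map K C C C C (\<lambda>x. x) R (\<Delta>\<^sub>0 c)))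
    \<alpha>"
proof -
  interpret hom_coassociative_rota_baxter_coalgebra K C \<Delta>\<^sub>0 \<alpha> R "\<zero>\<^bsub>K\<^esub>" by fact
  \<comment> \<open>The interpretation fixes the weight as zero, so the condition on
    \<open>wt\<close> holds by reflexivity.\<close>
  show ?thesis
    using hom_preLie_preLie_comult[OF refl] unfolding preLie_comult_def[abs_def] .
qed

end
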